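(* Suppose the residue characteristic of $F$ is odd. Let $\gamma=\mathrm{diag}(\alpha,\alpha^{-1})$ with $\alpha\in F^\times$, $\alpha\neq\pm1$, and suppose $\alpha\equiv1\pmod{\mathfrak p}$. Then $S(\gamma)^{-1}$ is not $\varepsilon$-conjugate to any element of $C$.
   Context: $F$ is a $p$-adic field of characteristic zero, $\mathcal O$ its ring of integers, $\mathfrak p$ its maximal ideal, $\varpi$ a uniformizer. $G=GL_2(F)$, $w=\begin{pmatrix}0&1\\1&0\end{pmatrix}$, $g^{\vdash}=w\,{}^tg\,w$. Elements $X,Y\in G$ are $\varepsilon$-conjugate if $Y=gXg^{\vdash}$ for some $g\in G$. $S(\gamma)=\gamma-I=\mathrm{diag}(\alpha-1,\alpha^{-1}-1)$. Let $E=F(\sqrt\varpi)$, embedded in $M_2(F)$ with $\varpi_E=\sqrt\varpi=\begin{pmatrix}0&1\\\varpi&0\end{pmatrix}$. Let $\mathcal L$ be a compact open subgroup of $G$ contained in $I_1=\begin{pmatrix}1+\mathfrak p&\mathcal O\\\mathfrak p&1+\mathfrak p\end{pmatrix}$ such that $G'=E^\times\mathcal L$ is a subgroup (the inducing subgroup in Kutzko's construction of a supercuspidal representation of $G$ by compact induction of a character of $G'$). Put $C_0=\mathcal O_E^\times\mathcal L$ and $C=C_0\cup\varpi_EC_0$; $C$ is the support of the function $f_G$ obtained by restricting to $C$ the extension by zero of that character. *)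

theory Defs
  imports "HOL-Analysis.Analysis" "HOL-Algebra.Coset"
begin

text \<open>The absolute value of a valued field is \<open>\<lambda>x. dist x 0\<close>, so that
  the library topology on the field, and on matrices over it, is the valuation topology.\<close>

class nonarch_valued_field = field + metric_space +
  assumes dist_translation: "dist x y = dist (x - y) 0"
    and dist_mult: "dist (x * y) 0 = dist x 0 * dist y 0"
    and dist_ultrametric: "dist x z \<le> max (dist x y) (dist y z)"
begin

definition ring_of_integers :: "'a set" where
  "ring_of_integers = {x. dist x 0 \<le> 1}"

definition maximal_ideal :: "'a set" where
  "maximal_ideal = {x. dist x 0 < 1}"

definition uniformizer :: "'a \<Rightarrow> bool" where
  "uniformizer \<pi> \<longleftrightarrow> \<pi> \<noteq> 0 \<and> maximal_ideal = (*) \<pi> ` ring_of_integers"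

definition residue_field :: "'a set set" where
  "residue_field = ring_of_integers //
     {(x, y). x \<in> ring_of_integers \<and> y \<in> ring_of_integers \<and> x - y \<in> maximal_ideal}"

end

text \<open>A p-adic field of characteristic zero: a field of characteristic zero that is complete for
  a nontrivial, discrete, non-archimedean absolute value with finite residue field. The existence
  of a uniformizer (nonzero by definition) gives nontriviality and discreteness.\<close>

class p_adic_field = nonarch_valued_field + field_char_0 + complete_space +
  assumes uniformizer_exists: "\<exists>\<pi>. uniformizer \<pi>"
    and finite_residue_field: "finite residue_field"

text \<open>The characteristic of the residue field; the least element exists because the residue field
  is finite.\<close>

definition residue_char :: "'a::p_adic_field itself \<Rightarrow> nat" where
  "residue_char _ = (LEAST n. n > 0 \<and> (of_nat n :: 'a) \<in> maximal_ideal)"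

type_synonym 'a mat2 = "'a^2^2"

definition mat2 :: "'a::zero \<Rightarrow> 'a \<Rightarrow> 'a \<Rightarrow> 'a \<Rightarrow> 'a mat2" where
  "mat2 a b c d = vector [vector [a, b], vector [c, d]]"

text \<open>Type \<open>'a mat2\<close> carries the componentwise product as \<open>(*)\<close>; the matrix product is \<open>(**)\<close>.\<close>

definition GL2 :: "('a::field mat2) monoid" where
  "GL2 = \<lparr>carrier = {g. invertible g}, mult = (**), one = mat 1\<rparr>"

definition w :: "'a::field mat2" where
  "w = mat2 0 1 1 0"

definition turnstile :: "'a::field mat2 \<Rightarrow> 'a mat2" where
  "turnstile g = w ** transpose g ** w"

definition eps_conjugate :: "'a::field mat2 \<Rightarrow> 'a mat2 \<Rightarrow> bool" where
  "eps_conjugate X Y \<longleftrightarrow> X \<in> carrier GL2 \<and> Y \<in> carrier GL2 \<and>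
     (\<exists>g\<in>carrier GL2. Y = g ** X ** turnstile g)"

definition S :: "'a::field mat2 \<Rightarrow> 'a mat2" where
  "S \<gamma> = \<gamma> - mat 1"

definition I1 :: "'a::p_adic_field mat2 set" where
  "I1 = {mat2 a b c d | a b c d. a - 1 \<in> maximal_ideal \<and> b \<in> ring_of_integers \<and>
                                c \<in> maximal_ideal \<and> d - 1 \<in> maximal_ideal}"

definition unif_E :: "'a::field \<Rightarrow> 'a mat2" where
  "unif_E \<pi> = mat2 0 1 \<pi> 0"

definition E :: "'a::field \<Rightarrow> 'a mat2 set" where
  "E \<pi> = {mat a + mat b ** unif_E \<pi> | a b. True}"

definition E_units :: "'a::field \<Rightarrow> 'a mat2 set" where
  "E_units \<pi> = E \<pi> - {0}"

definition matpow :: "'a::field mat2 \<Rightarrow> nat \<Rightarrow> 'a mat2" where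
  "matpow x n = (((**) x) ^^ n) (mat 1)"

text \<open>The ring of integers of \<open>E\<close> is the integral closure of that of \<open>F\<close>: the elements that are
  roots of a monic polynomial with integral coefficients.\<close>

definition O_E :: "'a::p_adic_field \<Rightarrow> 'a mat2 set" where
  "O_E \<pi> = {x \<in> E \<pi>. \<exists>n c. (\<forall>i<n. c i \<in> ring_of_integers) \<and>
                 matpow x n + (\<Sum>i<n. mat (c i) ** matpow x i) = 0}"

definition O_E_units :: "'a::p_adic_field \<Rightarrow> 'a mat2 set" where
  "O_E_units \<pi> = {x \<in> O_E \<pi>. \<exists>y\<in>O_E \<pi>. x ** y = mat 1}"

definition C0 :: "'a::p_adic_field \<Rightarrow> 'a mat2 set \<Rightarrow> 'a mat2 set" where
  "C0 \<pi> L = O_E_units \<pi> <#>\<^bsub>GL2\<^esub> L"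

definition C :: "'a::p_adic_field \<Rightarrow> 'a mat2 set \<Rightarrow> 'a mat2 set" where
  "C \<pi> L = C0 \<pi> L \<union> (unif_E \<pi> <#\<^bsub>GL2\<^esub> C0 \<pi> L)"

end

theory Submission
  imports Defs
begin

text \<open>If \<open>Y = g X g\<^sup>\<turnstile>\<close>, then \<open>Y w = g (X w) g\<^sup>T\<close>, so \<open>\<epsilon>\<close>-conjugacy of \<open>X\<close> and \<open>Y\<close> is
  congruence of the bilinear forms \<open>X w\<close> and \<open>Y w\<close>: with \<open>\<delta> = det g\<close>, the antisymmetric
  part is scaled by \<open>\<delta>\<close> and the discriminant of the symmetric part by \<open>\<delta>\<^sup>2\<close>. For
  \<open>X = S(\<gamma>)\<^sup>-\<^sup>1\<close> and \<open>Y = (y\<^sub>1, y\<^sub>2; y\<^sub>3, y\<^sub>4)\<close> this reads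
  \<open>y\<^sub>1 - y\<^sub>4 = \<delta> (\<alpha> + 1) / (\<alpha> - 1)\<close> and \<open>(y\<^sub>1 + y\<^sub>4)\<^sup>2 - 4 y\<^sub>2 y\<^sub>3 = \<delta>\<^sup>2\<close>. As \<open>2\<close> is a unit,
  so is \<open>\<alpha> + 1\<close>, whence \<open>|\<delta>| \<le> |y\<^sub>1 - y\<^sub>4|\<close>. But on \<open>C\<^sub>0\<close> the difference \<open>y\<^sub>1 - y\<^sub>4\<close> lies in the
  maximal ideal while the discriminant is a unit, and on \<open>\<varpi>\<^sub>E C\<^sub>0\<close> both \<open>y\<^sub>1\<close> and \<open>y\<^sub>4\<close> lie in the
  maximal ideal while the discriminant has valuation \<open>1\<close>; either way the
  discriminant is too large to be \<open>\<delta>\<^sup>2\<close>.\<close>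

section \<open>Ultrametric absolute values\<close>

abbreviation vabs :: "'a::nonarch_valued_field \<Rightarrow> real" where
  "vabs x \<equiv> dist x 0"

lemma vabs_one [simp]: "vabs (1 :: 'a::nonarch_valued_field) = 1"
proof -
  have "vabs (1 :: 'a) * vabs (1 :: 'a) = vabs (1 :: 'a)" using dist_mult[of "1 :: 'a" 1] by simp
  then show ?thesis by simp
qed

lemma vabs_minus [simp]: "vabs (- x) = vabs x"
  using dist_translation[of 0 x] by (simp add: dist_commute)

lemma vabs_add_le: "vabs (x + y) \<le> max (vabs x) (vabs y)"
  using dist_ultrametric[of x "- y" 0] dist_translation[of x "- y"] dist_commute[of 0 "- y"] by simp

lemma vabs_diff_le: "vabs (x - y) \<le> max (vabs x) (vabs y)"
  using vabs_add_le[of x "- y"] by simp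

text \<open>Since x = (x + y) - y and |y| is too small to attain the maximum, the ultrametric
  inequality also bounds |x| by |x + y|.\<close>

lemma vabs_add_eq_left: "vabs y < vabs x \<Longrightarrow> vabs (x + y) = vabs x"
  using vabs_add_le[of x y] vabs_diff_le[of "x + y" y] by auto

lemma vabs_diff_eq_max: "vabs x \<noteq> vabs y \<Longrightarrow> vabs (x - y) = max (vabs x) (vabs y)"
  using vabs_add_eq_left[of "- y" x] vabs_add_eq_left[of x "- y"]
  by (cases "vabs x < vabs y") (auto simp: max_def add.commute)

lemma vabs_power: "vabs (x ^ n) = vabs x ^ n"
  by (induction n) (auto simp: dist_mult)

lemma vabs_le_imp_mult_le:
  "vabs x \<le> 1 \<Longrightarrow> vabs y \<le> c \<Longrightarrow> vabs (x * y) \<le> c"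
  using mult_mono[of "vabs x" 1 "vabs y" c] by (simp add: dist_mult)

section \<open>Discreteness and the norm form of E\<close>

lemma vabs_uniformizer:
  assumes "uniformizer \<pi>"
  shows "0 < vabs \<pi>" "vabs \<pi> < 1"
proof -
  show "0 < vabs \<pi>" using assms by (simp add: uniformizer_def)
  have "\<pi> * 1 \<in> (*) \<pi> ` ring_of_integers"
    by (rule imageI) (simp add: ring_of_integers_def)
  then have "\<pi> \<in> maximal_ideal" using assms by (simp add: uniformizer_def)
  then show "vabs \<pi> < 1" by (simp add: maximal_ideal_def)
qed

text \<open>Discreteness: \<pi> generates the maximal ideal, so no element has absolute value
  strictly between |\<pi>| and 1.\<close>

lemma vabs_less_one_iff:
  fixes \<pi> x :: "'a::nonarch_valued_field"
  assumes "uniformizer \<pi>"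
  shows "vabs x < 1 \<longleftrightarrow> vabs x \<le> vabs \<pi>"
proof
  assume "vabs x < 1"
  then have "x \<in> maximal_ideal" by (simp add: maximal_ideal_def)
  then have "x \<in> (*) \<pi> ` ring_of_integers" using assms by (simp add: uniformizer_def)
  then obtain y where "x = \<pi> * y" "vabs y \<le> 1"
    by (auto simp: ring_of_integers_def)
  then show "vabs x \<le> vabs \<pi>"
    by (simp add: dist_mult mult_left_le)
next
  assume "vabs x \<le> vabs \<pi>"
  then show "vabs x < 1" using vabs_uniformizer(2)[OF assms] by simp
qed

text \<open>A square root of |\<pi>| would lie strictly between |\<pi>| and 1, against
  discreteness.\<close>

lemma vabs_square_neq_uniformizer:
  fixes \<pi> x :: "'a::nonarch_valued_field"
  assumes "uniformizer \<pi>"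
  shows "(vabs x)\<^sup>2 \<noteq> vabs \<pi>"
proof
  note \<pi> = vabs_uniformizer[OF assms]
  assume eq: "(vabs x)\<^sup>2 = vabs \<pi>"
  then have "vabs x < 1"
    using \<pi> by (metis linorder_not_less one_le_power)
  then have "vabs x \<le> vabs \<pi>" by (simp add: vabs_less_one_iff[OF assms])
  then have "(vabs x)\<^sup>2 \<le> (vabs \<pi>)\<^sup>2" by (simp add: power_mono)
  also have "\<dots> < vabs \<pi>" using mult_strict_left_mono[OF \<pi>(2,1)] by (simp add: power2_eq_square)
  finally show False using eq by simp
qed

text \<open>The square of the extension to \<open>E\<close> of the absolute value, at \<open>x + y \<varpi>\<^sub>E\<close>.\<close>

lemma vabs_norm_form:
  fixes \<pi> x y :: "'a::nonarch_valued_field"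
  assumes "uniformizer \<pi>"
  shows "vabs (x\<^sup>2 - \<pi> * y\<^sup>2) = max ((vabs x)\<^sup>2) (vabs \<pi> * (vabs y)\<^sup>2)"
proof (cases "y = 0")
  case True
  then show ?thesis by (simp add: vabs_power)
next
  case False
  \<comment> \<open>A tie would make |\<pi>| the square of |x / y|. Without a tie the ultrametric
    inequality is an equality.\<close>
  have "(vabs x)\<^sup>2 \<noteq> vabs \<pi> * (vabs y)\<^sup>2"
  proof
    assume *: "(vabs x)\<^sup>2 = vabs \<pi> * (vabs y)\<^sup>2"
    have "vabs (x / y) * vabs y = vabs x"
      using False by (simp flip: dist_mult)
    then have "(vabs (x / y))\<^sup>2 * (vabs y)\<^sup>2 = vabs \<pi> * (vabs y)\<^sup>2"
      using * by (simp flip: power_mult_distrib)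
    then show False
      using False vabs_square_neq_uniformizer[OF assms, of "x / y"] by simp
  qed
  then show ?thesis
    using vabs_diff_eq_max[of "x\<^sup>2" "\<pi> * y\<^sup>2"] by (simp add: dist_mult vabs_power)
qed

text \<open>The ultrametric inequality on E, stated for squares to avoid roots; the maximum formula
  reduces it to the coordinates.\<close>

lemma vabs_norm_form_add_le:
  fixes \<pi> x y :: "'a::nonarch_valued_field"
  assumes "uniformizer \<pi>"
    and "vabs (x\<^sup>2 - \<pi> * y\<^sup>2) \<le> B" "vabs (x'\<^sup>2 - \<pi> * y'\<^sup>2) \<le> B"
  shows "vabs ((x + x')\<^sup>2 - \<pi> * (y + y')\<^sup>2) \<le> B"
proof -
  have sq: "(vabs (a + b))\<^sup>2 \<le> max ((vabs a)\<^sup>2) ((vabs b)\<^sup>2)" for a b :: 'a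
    using vabs_add_le[of a b] power_mono[of "vabs (a + b)" _ 2] by (auto simp: max_def split: if_splits)
  have "vabs \<pi> * (vabs (y + y'))\<^sup>2 \<le> max (vabs \<pi> * (vabs y)\<^sup>2) (vabs \<pi> * (vabs y')\<^sup>2)"
    using mult_left_mono[OF sq[of y y'], of "vabs \<pi>"] by (simp add: max_mult_distrib_left)
  then show ?thesis
    using assms(2,3) sq[of x x'] unfolding vabs_norm_form[OF assms(1)] by linarith
qed

text \<open>If |y| > 1, discreteness gives |\<pi>| |y| \<ge> 1, so the second term of the maximum is
  at least |y| > 1. Hence |y| \<le> 1, that term is below 1, and the first term must be 1.\<close>

lemma vabs_norm_form_eq_one:
  fixes \<pi> x y :: "'a::nonarch_valued_field"
  assumes "uniformizer \<pi>" "vabs (x\<^sup>2 - \<pi> * y\<^sup>2) = 1"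
  shows "vabs x = 1" "vabs y \<le> 1"
proof -
  note \<pi> = vabs_uniformizer[OF assms(1)]
  have max: "max ((vabs x)\<^sup>2) (vabs \<pi> * (vabs y)\<^sup>2) = 1"
    using assms by (simp add: vabs_norm_form)
  show y: "vabs y \<le> 1"
  proof (rule ccontr)
    assume "\<not> vabs y \<le> 1"
    then have y1: "vabs y > 1" by simp
    then have "y \<noteq> 0" by auto
    then have inv: "vabs (inverse y) * vabs y = 1"
      by (simp flip: dist_mult)
    then have "vabs (inverse y) < 1"
      using y1 by (smt (verit) mult_le_cancel_right1)
    then have "vabs (inverse y) \<le> vabs \<pi>"
      by (simp add: vabs_less_one_iff[OF assms(1)])
    then have "1 \<le> vabs \<pi> * vabs y"
      using y1 inv by (metis mult_right_mono zero_le_dist)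
    then have "vabs y \<le> vabs \<pi> * (vabs y)\<^sup>2"
      using y1 mult_right_mono[of 1 "vabs \<pi> * vabs y" "vabs y"] by (simp add: power2_eq_square)
    then show False using max y1 by linarith
  qed
  have "vabs \<pi> * (vabs y)\<^sup>2 < 1"
    using \<pi> y by (smt (verit) mult_left_le power_le_one zero_le_dist)
  then have "(vabs x)\<^sup>2 = 1" using max by linarith
  then show "vabs x = 1" by (simp add: power2_eq_1_iff) (smt (verit) zero_le_dist)
qed

text \<open>If |2| < 1, then 2 is the least positive integer in the maximal ideal, since |1| =
  1.\<close>

lemma vabs_two:
  assumes "odd (residue_char TYPE('a::p_adic_field))"
  shows "vabs (2 :: 'a) = 1"
proof (rule antisym)
  show "vabs (2 :: 'a) \<le> 1" using vabs_add_le[of "1 :: 'a" 1] by simp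
  show "1 \<le> vabs (2 :: 'a)"
  proof (rule ccontr)
    assume "\<not> 1 \<le> vabs (2 :: 'a)"
    then have "residue_char TYPE('a) = 2"
      unfolding residue_char_def
    proof (intro Least_equality)
      fix n :: nat assume "0 < n \<and> (of_nat n :: 'a) \<in> maximal_ideal"
      then show "2 \<le> n"
        by (cases "n = 1") (auto simp: maximal_ideal_def)
    qed (simp add: maximal_ideal_def)
    then show False using assms by simp
  qed
qed

section \<open>Two-by-two matrices in coordinates\<close>

lemma mat2_nth [simp]:
  "mat2 a b c d $ 1 $ 1 = a" "mat2 a b c d $ 1 $ 2 = b"
  "mat2 a b c d $ 2 $ 1 = c" "mat2 a b c d $ 2 $ 2 = d"
  by (simp_all add: mat2_def)

lemma mat2_eq_iff: "A = B \<longleftrightarrow> A $ 1 $ 1 = B $ 1 $ 1 \<and> A $ 1 $ 2 = B $ 1 $ 2 \<and>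
    A $ 2 $ 1 = B $ 2 $ 1 \<and> A $ 2 $ 2 = B $ 2 $ 2" for A B :: "'a mat2"
  by (auto simp: vec_eq_iff forall_2)

lemma mat2_eta: "mat2 (A $ 1 $ 1) (A $ 1 $ 2) (A $ 2 $ 1) (A $ 2 $ 2) = A"
  by (simp add: mat2_eq_iff)

lemma mat_eq_mat2: "mat k = mat2 k 0 0 k"
  by (simp add: mat2_eq_iff mat_def)

lemma mat2_mult: "mat2 a b c d ** mat2 a' b' c' d' =
    mat2 (a * a' + b * c') (a * b' + b * d') (c * a' + d * c') (c * b' + d * d')"
  for a :: "'a::semiring_1"
  by (simp add: mat2_eq_iff matrix_matrix_mult_def sum_2)

lemma mat2_add: "mat2 a b c d + mat2 a' b' c' d' = mat2 (a + a') (b + b') (c + c') (d + d')"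
  for a :: "'a::monoid_add"
  by (simp add: mat2_eq_iff)

lemma turnstile_mat2: "turnstile (mat2 p q r s) = mat2 s q r p"
proof -
  have "transpose (mat2 p q r s) = mat2 p r q s"
    by (simp add: mat2_eq_iff transpose_def)
  then show ?thesis by (simp add: turnstile_def w_def mat2_mult)
qed

lemma det_mat2: "det (mat2 a b c d) = a * d - b * c"
  for a :: "'a::comm_ring_1"
  by (simp add: det_2)

section \<open>Integers and units of E, with \<open>det\<close> as the norm\<close>

lemma mem_E_iff: "z \<in> E \<pi> \<longleftrightarrow> (\<exists>x y. z = mat2 x y (\<pi> * y) x)"
  by (simp add: E_def unif_E_def mat_eq_mat2 mat2_mult mat2_add mult.commute)

lemma E_mult: "z \<in> E \<pi> \<Longrightarrow> z' \<in> E \<pi> \<Longrightarrow> z ** z' \<in> E \<pi>"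
  by (auto simp: mem_E_iff mat2_mult) (auto simp: mat2_eq_iff algebra_simps)

lemma E_mat: "mat k \<in> E \<pi>"
  by (auto simp: mem_E_iff mat_eq_mat2 mat2_eq_iff)

lemma E_add: "z \<in> E \<pi> \<Longrightarrow> z' \<in> E \<pi> \<Longrightarrow> z + z' \<in> E \<pi>"
  by (auto simp: mem_E_iff mat2_add mat2_eq_iff algebra_simps)

lemma matpow_simps [simp]: "matpow z 0 = mat 1" "matpow z (Suc n) = z ** matpow z n"
  by (simp_all add: matpow_def)

lemma E_matpow: "z \<in> E \<pi> \<Longrightarrow> matpow z n \<in> E \<pi>"
  by (induction n) (auto intro: E_mat E_mult)

lemma det_matpow: "det (matpow z n) = det z ^ n"
  by (induction n) (auto simp: det_mul)

lemma vabs_det_add_le: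
  fixes \<pi> :: "'a::nonarch_valued_field"
  assumes "uniformizer \<pi>" "z \<in> E \<pi>" "z' \<in> E \<pi>" "vabs (det z) \<le> B" "vabs (det z') \<le> B"
  shows "vabs (det (z + z')) \<le> B"
proof -
  obtain x y x' y' where "z = mat2 x y (\<pi> * y) x" "z' = mat2 x' y' (\<pi> * y') x'"
    using assms(2,3) by (auto simp: mem_E_iff)
  then show ?thesis
    using vabs_norm_form_add_le[OF assms(1), of x y B x' y'] assms(4,5)
    by (simp add: mat2_add det_mat2 power2_eq_square algebra_simps)
qed

text \<open>The bound for a sum of two terms is available inside \<open>E \<pi>\<close> only, so
  membership is carried through the induction.\<close>

lemma vabs_det_sum_le:
  fixes \<pi> :: "'a::nonarch_valued_field"
  assumes "uniformizer \<pi>" "0 \<le> B" "\<And>i. i < n \<Longrightarrow> f i \<in> E \<pi> \<and> vabs (det (f i)) \<le> B"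
  shows "(\<Sum>i<n::nat. f i) \<in> E \<pi> \<and> vabs (det (\<Sum>i<n. f i)) \<le> B"
  using assms(3)
proof (induction n)
  case 0
  then show ?case using assms(2) E_mat[of 0 \<pi>] by (simp add: det_2)
next
  case (Suc n)
  then show ?case
    by (simp add: E_add vabs_det_add_le[OF assms(1)])
qed

text \<open>If the norm exceeded 1, the leading term of the monic equation would be strictly larger
  than every other term and could not cancel.\<close>

lemma vabs_det_O_E:
  fixes \<pi> :: "'a::p_adic_field"
  assumes \<pi>: "uniformizer \<pi>" and "z \<in> O_E \<pi>"
  shows "vabs (det z) \<le> 1"
proof (rule ccontr)
  assume "\<not> vabs (det z) \<le> 1"
  then have gt: "vabs (det z) > 1" by simp
  obtain n c where zE: "z \<in> E \<pi>" and c: "\<And>i. i < n \<Longrightarrow> vabs (c i) \<le> 1"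
    and eq: "matpow z n + (\<Sum>i<n. mat (c i) ** matpow z i) = 0"
    using assms(2) by (auto simp: O_E_def ring_of_integers_def)
  define s where "s = (\<Sum>i<n. mat (c i) ** matpow z i)"
  have eq': "s = - matpow z n"
    using eq by (simp add: s_def eq_neg_iff_add_eq_0 add.commute)
  show False
  proof (cases n)
    case 0
    \<comment> \<open>Degree 0 means the constant polynomial 1, which has no root.\<close>
    then show False using eq by (simp add: mat_eq_mat2 mat2_eq_iff)
  next
    case (Suc m)
    have "vabs (det (mat (c i) ** matpow z i)) \<le> vabs (det z) ^ m" if "i < n" for i
    proof -
      have "vabs (det (mat (c i) ** matpow z i)) = (vabs (c i))\<^sup>2 * vabs (det z) ^ i"
        by (simp add: det_mul det_matpow mat_eq_mat2 det_mat2 dist_mult vabs_power power2_eq_square)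
      also have "\<dots> \<le> 1 * vabs (det z) ^ i"
        using c[OF that] by (intro mult_right_mono) (auto simp: power_le_one)
      also have "\<dots> \<le> vabs (det z) ^ m"
        using that gt Suc by (auto intro: power_increasing)
      finally show ?thesis .
    qed
    then have "vabs (det s) \<le> vabs (det z) ^ m"
      using vabs_det_sum_le[OF \<pi>, of "vabs (det z) ^ m" n "\<lambda>i. mat (c i) ** matpow z i"]
        zE by (simp add: E_mult E_mat E_matpow s_def)
    \<comment> \<open>The sign disappears because the determinant is quadratic in the
      entries.\<close>
    moreover have "det s = det (matpow z n)"
      by (simp add: eq' det_2)
    ultimately have "vabs (det z) ^ Suc m \<le> vabs (det z) ^ m"
      by (simp add: det_mul det_matpow vabs_power dist_mult Suc)
    moreover have "vabs (det z) ^ m < vabs (det z) ^ Suc m"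
      using gt by (intro power_strict_increasing) auto
    ultimately show False by linarith
  qed
qed

text \<open>The norms of a unit and of its inverse are at most 1 in absolute value and multiply to
  1, so both have absolute value 1.\<close>

lemma O_E_units_cases:
  fixes \<pi> :: "'a::p_adic_field"
  assumes \<pi>: "uniformizer \<pi>" and u: "u \<in> O_E_units \<pi>"
  obtains x y where "u = mat2 x y (\<pi> * y) x" "vabs x = 1" "vabs y \<le> 1"
proof -
  obtain v where v: "u \<in> O_E \<pi>" "v \<in> O_E \<pi>" "u ** v = mat 1"
    using u by (auto simp: O_E_units_def)
  have "vabs (det u) * vabs (det v) = 1"
    using v(3) by (metis det_I det_mul dist_mult vabs_one)
  then have "vabs (det u) = 1"
    using vabs_det_O_E[OF \<pi> v(1)] vabs_det_O_E[OF \<pi> v(2)]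
    by (smt (verit) mult_left_le zero_le_dist)
  moreover obtain x y where "u = mat2 x y (\<pi> * y) x"
    using v(1) by (auto simp: O_E_def mem_E_iff)
  ultimately show thesis
    using vabs_norm_form_eq_one[OF \<pi>, of x y] that
    by (simp add: det_mat2 power2_eq_square algebra_simps)
qed

text \<open>Modulo the maximal ideal, a unit of E is upper triangular with equal diagonal entries
  \<open>x\<close>, and an element of \<open>I1\<close> is upper unitriangular; their product keeps
  the diagonal \<open>x\<close>, \<open>x\<close>.\<close>

lemma C0_cases:
  fixes \<pi> :: "'a::p_adic_field"
  assumes \<pi>: "uniformizer \<pi>" and "L \<subseteq> I1" and "Y \<in> C0 \<pi> L"
  obtains x y1 y2 y3 y4 where "Y = mat2 y1 y2 y3 y4" "vabs x = 1" "vabs (y1 - x) < 1"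
    "vabs y2 \<le> 1" "vabs y3 < 1" "vabs (y4 - x) < 1"
proof -
  obtain u l where "u \<in> O_E_units \<pi>" "l \<in> I1" and Y: "Y = u ** l"
    using assms(2,3) by (auto simp: C0_def set_mult_def GL2_def)
  then obtain x y a b c d where u: "u = mat2 x y (\<pi> * y) x" "vabs x = 1" "vabs y \<le> 1"
    and l: "l = mat2 a b c d" "vabs (a - 1) < 1" "vabs b \<le> 1" "vabs c < 1" "vabs (d - 1) < 1"
    by (elim O_E_units_cases[OF \<pi>]) (auto simp: I1_def maximal_ideal_def ring_of_integers_def)
  have mlt: "vabs (s * t) < 1" if "vabs s \<le> 1" "vabs t < 1" for s t :: 'a
    using that mult_left_le_one_le[of "vabs t" "vabs s"] by (simp add: dist_mult)
  have alt: "vabs (s + t) < 1" if "vabs s < 1" "vabs t < 1" for s t :: 'a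
    using that vabs_add_le[of s t] by simp
  have a: "vabs a \<le> 1" using vabs_add_le[of "a - 1" 1] l(2) by simp
  have d: "vabs d \<le> 1" using vabs_add_le[of "d - 1" 1] l(5) by simp
  have \<pi>y: "vabs (y * \<pi>) < 1" using u(3) vabs_uniformizer(2)[OF \<pi>] by (rule mlt)
  show thesis
  proof (rule that)
    show "Y = mat2 (x * a + y * c) (x * b + y * d) (\<pi> * y * a + x * c) (\<pi> * y * b + x * d)"
      by (simp add: Y u l mat2_mult)
    show "vabs x = 1" by fact
    have "vabs (x * (a - 1) + y * c) < 1" using u l by (intro alt mlt) auto
    then show "vabs (x * a + y * c - x) < 1" by (simp add: algebra_simps)
    show "vabs (x * b + y * d) \<le> 1"
      using vabs_add_le[of "x * b" "y * d"] u l d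
        vabs_le_imp_mult_le[of x b 1] vabs_le_imp_mult_le[of y d 1] by simp
    have "vabs (a * (y * \<pi>) + x * c) < 1" by (intro alt mlt \<pi>y) (use u l a in auto)
    then show "vabs (\<pi> * y * a + x * c) < 1" by (simp add: algebra_simps)
    have "vabs (b * (y * \<pi>) + x * (d - 1)) < 1" by (intro alt mlt \<pi>y) (use u l in auto)
    then show "vabs (\<pi> * y * b + x * d - x) < 1" by (simp add: algebra_simps)
  qed
qed

lemma matrix_inv_mat2_diag:
  fixes a d :: "'a::field"
  assumes "a \<noteq> 0" "d \<noteq> 0"
  shows "matrix_inv (mat2 a 0 0 d) = mat2 (inverse a) 0 0 (inverse d)"
proof -
  let ?A = "mat2 a 0 0 d" and ?B = "mat2 (inverse a) 0 0 (inverse d)"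
  have B: "?A ** ?B = mat 1" "?B ** ?A = mat 1"
    using assms by (simp_all add: mat2_mult mat_eq_mat2)
  \<comment> \<open>\<open>matrix_inv\<close> is a choice term; the witness \<open>?B\<close> shows
    that the choice is a genuine inverse.\<close>
  then have "matrix_inv ?A ** ?A = mat 1"
    unfolding matrix_inv_def by (metis (mono_tags, lifting) someI_ex)
  then show ?thesis
    by (metis B(1) matrix_mul_assoc matrix_mul_lid matrix_mul_rid)
qed

section \<open>Invariants of \<epsilon>-conjugacy\<close>

lemma eps_conjugate_invariants:
  fixes \<alpha> :: "'a::field"
  assumes "\<alpha> \<noteq> 0" "\<alpha> \<noteq> 1"
    and "eps_conjugate (matrix_inv (S (mat2 \<alpha> 0 0 (inverse \<alpha>)))) (mat2 y1 y2 y3 y4)"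
  obtains \<delta> where "(y1 - y4) * (\<alpha> - 1) = \<delta> * (\<alpha> + 1)" "(y1 + y4)\<^sup>2 - 4 * (y2 * y3) = \<delta>\<^sup>2"
proof -
  define a d where "a = inverse (\<alpha> - 1)" and "d = inverse (inverse \<alpha> - 1)"
  have "S (mat2 \<alpha> 0 0 (inverse \<alpha>)) = mat2 (\<alpha> - 1) 0 0 (inverse \<alpha> - 1)"
    by (simp add: S_def mat_eq_mat2 mat2_eq_iff)
  moreover have "\<alpha> - 1 \<noteq> 0" "inverse \<alpha> - 1 \<noteq> 0"
    using assms by auto
  ultimately have X: "matrix_inv (S (mat2 \<alpha> 0 0 (inverse \<alpha>))) = mat2 a 0 0 d"
    by (simp add: matrix_inv_mat2_diag a_def d_def)
  have a: "a * (\<alpha> - 1) = 1" using \<open>\<alpha> - 1 \<noteq> 0\<close> by (simp add: a_def)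
  \<comment> \<open>The trace of the inverse of S(\<gamma>) is -1. So the discriminant is 1 before
    scaling, and a - d = 2a + 1 = (\<alpha> + 1) / (\<alpha> - 1).\<close>
  have d: "d = - 1 - a" using assms by (simp add: a_def d_def field_simps)
  obtain p q r s where "mat2 y1 y2 y3 y4 = mat2 p q r s ** mat2 a 0 0 d ** turnstile (mat2 p q r s)"
    using assms(3) unfolding eps_conjugate_def X by (metis mat2_eta)
  then have y: "y1 = p * a * s + q * d * r" "y2 = p * a * q + q * d * p"
      "y3 = r * a * s + s * d * r" "y4 = r * a * q + s * d * p"
    by (simp_all add: turnstile_mat2 mat2_mult mat2_eq_iff)
  show thesis
  proof
    have "(y1 - y4) * (\<alpha> - 1) = (p * s - q * r) * (2 * (a * (\<alpha> - 1)) + (\<alpha> - 1))"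
      by (simp add: y d algebra_simps)
    then show "(y1 - y4) * (\<alpha> - 1) = (p * s - q * r) * (\<alpha> + 1)" by (simp add: a add.commute)
    show "(y1 + y4)\<^sup>2 - 4 * (y2 * y3) = (p * s - q * r)\<^sup>2"
      by (simp add: y d power2_eq_square algebra_simps)
  qed
qed

theorem proposition22:
  fixes \<pi> \<alpha> :: "'a::p_adic_field" and L :: "'a mat2 set"
  assumes "odd (residue_char TYPE('a))"
    and "uniformizer \<pi>"
    and "subgroup L GL2"
    and "compact L"
    and "openin (top_of_set (carrier GL2)) L"
    and "L \<subseteq> I1"
    and "subgroup (E_units \<pi> <#>\<^bsub>GL2\<^esub> L) GL2"
    and "\<alpha> \<noteq> 0" and "\<alpha> \<noteq> 1" and "\<alpha> \<noteq> -1"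
    and "\<alpha> - 1 \<in> maximal_ideal"
  shows "\<forall>Y\<in>C \<pi> L. \<not> eps_conjugate (matrix_inv (S (mat2 \<alpha> 0 0 (inverse \<alpha>)))) Y"
proof (intro ballI notI)
  fix Y
  assume YC: "Y \<in> C \<pi> L" and conj: "eps_conjugate (matrix_inv (S (mat2 \<alpha> 0 0 (inverse \<alpha>)))) Y"
  note \<pi> = vabs_uniformizer[OF assms(2)] and two = vabs_two[OF assms(1)]
  have four: "vabs (4 :: 'a) = 1" using dist_mult[of "2 :: 'a" 2] two by simp
  have \<alpha>1: "vabs (\<alpha> - 1) < 1" using assms(11) by (simp add: maximal_ideal_def)
  have \<alpha>2: "vabs (\<alpha> + 1) = 1"
    using vabs_add_eq_left[of "\<alpha> - 1" 2] \<alpha>1 two by (simp add: algebra_simps)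
  have disc_le: "vabs ((y1 + y4)\<^sup>2 - 4 * (y2 * y3)) \<le> (vabs (y1 - y4))\<^sup>2"
    if "Y = mat2 y1 y2 y3 y4" for y1 y2 y3 y4
  proof -
    obtain \<delta> where \<delta>: "(y1 - y4) * (\<alpha> - 1) = \<delta> * (\<alpha> + 1)" "(y1 + y4)\<^sup>2 - 4 * (y2 * y3) = \<delta>\<^sup>2"
      using eps_conjugate_invariants[OF assms(8,9)] conj \<open>Y = _\<close> by metis
    have "vabs (y1 - y4) * vabs (\<alpha> - 1) = vabs \<delta> * vabs (\<alpha> + 1)"
      using \<delta>(1) by (simp flip: dist_mult)
    then have "vabs \<delta> \<le> vabs (y1 - y4)"
      using \<alpha>1 \<alpha>2 by (metis less_imp_le mult.right_neutral mult_left_le zero_le_dist)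
    then show ?thesis by (simp add: \<delta>(2) vabs_power power_mono)
  qed
  consider "Y \<in> C0 \<pi> L" | Z where "Z \<in> C0 \<pi> L" "Y = unif_E \<pi> ** Z"
    using YC by (auto simp: C_def l_coset_def GL2_def)
  then show False
  proof cases
    case 1
    then obtain x y1 y2 y3 y4 where Y: "Y = mat2 y1 y2 y3 y4" and x: "vabs x = 1"
      and y: "vabs (y1 - x) < 1" "vabs y2 \<le> 1" "vabs y3 < 1" "vabs (y4 - x) < 1"
      by (elim C0_cases[OF assms(2,6)])
    have "vabs (y1 - y4) < 1"
      using vabs_diff_le[of "y1 - x" "y4 - x"] y by simp
    then have "(vabs (y1 - y4))\<^sup>2 < 1" by (simp add: power_less_one_iff)
    \<comment> \<open>The trace is 2x up to the maximal ideal, hence a unit because 2 is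
      one.\<close>
    moreover have "vabs (2 * x + ((y1 - x) + (y4 - x))) = vabs (2 * x)"
      using vabs_add_le[of "y1 - x" "y4 - x"] y x two by (intro vabs_add_eq_left) (simp add: dist_mult)
    then have "vabs (y1 + y4) = 1" by (simp add: algebra_simps dist_mult two x)
    moreover have "vabs (4 * (y2 * y3)) < 1"
      using y mult_left_le_one_le[of "vabs y3" "vabs y2"] by (simp add: dist_mult four)
    ultimately show False
      using disc_le[OF Y] vabs_diff_eq_max[of "(y1 + y4)\<^sup>2" "4 * (y2 * y3)"]
      by (simp add: vabs_power)
  next
    case 2
    then obtain x z1 z2 z3 z4 where Z: "Z = mat2 z1 z2 z3 z4" and x: "vabs x = 1"
      and z: "vabs (z1 - x) < 1" "vabs z2 \<le> 1" "vabs z3 < 1" "vabs (z4 - x) < 1"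
      by (elim C0_cases[OF assms(2,6)])
    \<comment> \<open>Multiplying by \<open>unif_E \<pi>\<close> swaps the rows and scales the new
      second row, so the units \<open>z1\<close>, \<open>z4\<close> move to the
      antidiagonal.\<close>
    have Y: "Y = mat2 z3 z4 (\<pi> * z1) (\<pi> * z2)"
      by (simp add: 2 Z unif_E_def mat2_mult)
    have z1: "vabs z1 = 1" using vabs_add_eq_left[of "z1 - x" x] z x by simp
    have z4: "vabs z4 = 1" using vabs_add_eq_left[of "z4 - x" x] z x by simp
    \<comment> \<open>By discreteness both diagonal entries of \<open>Y\<close> are at most |\<pi>|.
      Their squared sum and difference then stay below |\<pi>|, the size of the antidiagonal term,
      which thus decides the discriminant.\<close>
    have z3: "vabs z3 \<le> vabs \<pi>" using z by (simp add: vabs_less_one_iff[OF assms(2)])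
    have z2: "vabs (\<pi> * z2) \<le> vabs \<pi>" using z(2) by (simp add: dist_mult mult_left_le)
    have "(vabs (z3 - \<pi> * z2))\<^sup>2 \<le> (vabs \<pi>)\<^sup>2" "(vabs (z3 + \<pi> * z2))\<^sup>2 \<le> (vabs \<pi>)\<^sup>2"
      using vabs_diff_le[of z3 "\<pi> * z2"] vabs_add_le[of z3 "\<pi> * z2"] z2 z3
      by (auto intro!: power_mono)
    moreover have "(vabs \<pi>)\<^sup>2 < vabs \<pi>"
      using mult_strict_left_mono[OF \<pi>(2,1)] by (simp add: power2_eq_square)
    moreover have "vabs (4 * (z4 * (\<pi> * z1))) = vabs \<pi>"
      by (simp add: dist_mult four z1 z4)
    ultimately show False
      using disc_le[OF Y] vabs_diff_eq_max[of "(z3 + \<pi> * z2)\<^sup>2" "4 * (z4 * (\<pi> * z1))"]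
      unfolding vabs_power by linarith
  qed
qed

end
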